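(* For any $K>\sigma>0$ there exists a $K$-subgaussian distribution $\mathbb{P}$ on $\mathbb{R}$ such that $\mathbb{P}*\mathcal{N}(0,\sigma^2)$ does not satisfy the $T_2$-transportation inequality, that is, $T_2(\mathbb{P}*\mathcal{N}(0,\sigma^2))=\infty$; and hence $\mathbb{P}*\mathcal{N}(0,\sigma^2)$ does not satisfy the log-Sobolev inequality either.
   Context: A probability distribution $\mathbb{P}$ on $\mathbb{R}$ is $K$-subgaussian if, for $X\sim\mathbb{P}$, $\mathbb{E}[e^{\lambda (X-\mathbb{E}[X])}]\le e^{\frac12K^2\lambda^2}$ for all $\lambda\in\mathbb{R}$. $*$ is convolution of measures. $W_2^2(\mu,\nu)=\inf \mathbb{E}|X-Y|^2$ over all couplings of $\mu,\nu$, and $D_{KL}(\mu\|\nu)=\int f\log f\,d\nu$ with $f=\frac{d\mu}{d\nu}$ if $\mu\ll\nu$ and $+\infty$ otherwise. A probability measure $\nu$ satisfies the $T_2$ inequality if there is a finite constant $C$ such that $W_2^2(\mathbb{Q},\nu)\le C\,D_{KL}(\mathbb{Q}\|\nu)$ for all probability measures $\mathbb{Q}$; $T_2(\nu)$ is the infimum of such constants ($+\infty$ if there is none). A probability measure $\mu$ on $\mathbb{R}$ satisfies the log-Sobolev inequality if there is a finite constant $C$ such that $\int f^2\log f^2\,d\mu\le C\int|f'|^2\,d\mu$ for all smooth compactly supported $f$ with $\int f^2d\mu=1$. *)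

theory Defs
  imports "HOL-Probability.Probability"
begin

text \<open>Integrability is required explicitly, because the Bochner integral of a
  non-integrable function is 0.\<close>

definition subgaussian :: "real \<Rightarrow> real measure \<Rightarrow> bool" where
  "subgaussian K P \<longleftrightarrow> real_distribution P \<and> integrable P (\<lambda>x. x) \<and>
     (\<forall>t::real. integrable P (\<lambda>x. exp (t * (x - (\<integral>y. y \<partial>P)))) \<and>
        (\<integral>x. exp (t * (x - (\<integral>y. y \<partial>P))) \<partial>P) \<le> exp (K\<^sup>2 * t\<^sup>2 / 2))"

text \<open>The second parameter is the standard deviation, as in \<^const>\<open>normal_density\<close>.\<close>

definition normal_measure :: "real \<Rightarrow> real \<Rightarrow> real measure" where
  "normal_measure m \<sigma> = density lborel (\<lambda>x. ennreal (normal_density m \<sigma> x))"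

definition couplings :: "real measure \<Rightarrow> real measure \<Rightarrow> (real \<times> real) measure set" where
  "couplings \<mu> \<nu> = {\<gamma>. prob_space \<gamma> \<and> sets \<gamma> = sets (borel \<Otimes>\<^sub>M borel) \<and>
     distr \<gamma> borel fst = \<mu> \<and> distr \<gamma> borel snd = \<nu>}"

definition W2_squared :: "real measure \<Rightarrow> real measure \<Rightarrow> ennreal" where
  "W2_squared \<mu> \<nu> = (INF \<gamma>\<in>couplings \<mu> \<nu>. \<integral>\<^sup>+(x, y). ennreal (\<bar>x - y\<bar>\<^sup>2) \<partial>\<gamma>)"

text \<open>\<^const>\<open>KL_divergence\<close> is real-valued, so it cannot express the value \<open>\<infinity>\<close>.
  For probability measures \<open>\<mu> \<lless> \<nu>\<close>, the function \<open>f * ln f\<close> (with \<open>0 * ln 0 = 0\<close>) is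
  bounded below by \<open>- exp (-1)\<close>, so its \<open>\<nu>\<close>-integral always exists in \<open>(-\<infinity>, \<infinity>]\<close>,
  and it is \<open>\<infinity>\<close> exactly when \<open>f * ln f\<close> is not integrable.
  Note that \<open>absolutely_continuous \<nu> \<mu>\<close> means \<open>\<mu> \<lless> \<nu>\<close>.\<close>

definition D_KL :: "real measure \<Rightarrow> real measure \<Rightarrow> ereal" where
  "D_KL \<mu> \<nu> =
     (let f = (\<lambda>x. enn2real (RN_deriv \<nu> \<mu> x)) in
      if absolutely_continuous \<nu> \<mu> \<and> integrable \<nu> (\<lambda>x. f x * ln (f x))
      then ereal (\<integral>x. f x * ln (f x) \<partial>\<nu>) else \<infinity>)"

text \<open>In \<^typ>\<open>ereal\<close>, \<open>0 * \<infinity> = 0\<close>. This convention is harmless: it affects only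
  \<open>C = 0\<close>, where the inequality fails for every \<open>Q \<noteq> \<nu>\<close> because \<open>W2_squared Q \<nu> > 0\<close>.\<close>

definition T2_inequality :: "real measure \<Rightarrow> real \<Rightarrow> bool" where
  "T2_inequality \<nu> C \<longleftrightarrow>
     (\<forall>Q. real_distribution Q \<longrightarrow> enn2ereal (W2_squared Q \<nu>) \<le> ereal C * D_KL Q \<nu>)"

definition satisfies_T2 :: "real measure \<Rightarrow> bool" where
  "satisfies_T2 \<nu> \<longleftrightarrow> (\<exists>C. T2_inequality \<nu> C)"

text \<open>The infimum of the empty set is \<open>\<infinity>\<close> in \<^typ>\<open>ereal\<close>.\<close>

definition T2_constant :: "real measure \<Rightarrow> ereal" where
  "T2_constant \<nu> = Inf (ereal ` {C. T2_inequality \<nu> C})"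

definition smooth :: "(real \<Rightarrow> real) \<Rightarrow> bool" where
  "smooth f \<longleftrightarrow> (\<forall>n x. (deriv ^^ n) f differentiable (at x))"

definition compactly_supported :: "(real \<Rightarrow> real) \<Rightarrow> bool" where
  "compactly_supported f \<longleftrightarrow> compact (closure {x. f x \<noteq> 0})"

definition satisfies_LSI :: "real measure \<Rightarrow> bool" where
  "satisfies_LSI \<mu> \<longleftrightarrow> (\<exists>C::real. \<forall>f. smooth f \<longrightarrow> compactly_supported f \<longrightarrow>
     (\<integral>x. (f x)\<^sup>2 \<partial>\<mu>) = 1 \<longrightarrow>
     (\<integral>x. (f x)\<^sup>2 * ln ((f x)\<^sup>2) \<partial>\<mu>) \<le> C * (\<integral>x. \<bar>deriv f x\<bar>\<^sup>2 \<partial>\<mu>))"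

end

theory Submission
  imports Defs "HOL-Real_Asymp.Real_Asymp"
begin

text \<open>Write \<open>\<nu> = P \<star> N(0, \<sigma>\<^sup>2)\<close>. The distribution \<open>P\<close> is the law of \<open>T X\<close>, where \<open>X\<close> is
  \<open>N(0, K\<^sup>2)\<close>-distributed and \<open>T\<close> rounds \<open>\<bar>X\<bar>\<close> down to the set \<open>{0} \<union> {k! | k}\<close> and keeps the
  sign. Since \<open>T\<close> is odd and \<open>\<bar>T x\<bar> \<le> \<bar>x\<bar>\<close>, symmetry gives
  \<open>E exp (t T X) = E cosh (t T X) \<le> E cosh (t X) = exp (K\<^sup>2 t\<^sup>2 / 2)\<close>, so \<open>P\<close> is
  \<open>K\<close>-subgaussian (lemma \<open>odd_contraction_subgaussian\<close>).

  Nevertheless \<open>P\<close> keeps the heavy tail of \<open>N(0, K\<^sup>2)\<close> at every factorial: with \<open>r = (k + 1)!\<close>,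
  the \<open>P\<close>-mass \<open>p\<close> of \<open>[r, \<infinity>)\<close> is about \<open>exp (- r\<^sup>2 / 2K\<^sup>2)\<close>, while the next atom below \<open>r\<close> is
  \<open>k!\<close>, which is negligible against \<open>r\<close>. Just below \<open>r\<close> the smoothed measure \<open>\<nu>\<close> receives
  only about \<open>exp (- r\<^sup>2 / 2\<sigma>\<^sup>2)\<close> from the atoms up to \<open>k!\<close>, much less than \<open>p\<close> because
  \<open>\<sigma> < K\<close>, and only a small fraction of \<open>p\<close> from the atoms beyond \<open>r\<close>. So \<open>\<nu>\<close> has
  arbitrarily long intervals \<open>[a, b]\<close> arbitrarily far out with
  \<open>\<nu> [a, b] \<le> \<nu> (b, \<infinity>) / 2\<close>: it is bottlenecked (lemma \<open>rounded_normal_bottlenecked\<close>).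

  A bottleneck defeats both inequalities. Put \<open>q = \<nu> (b, \<infinity>)\<close>.

  For the transport inequality, double \<open>\<nu>\<close> on \<open>(b, \<infinity>)\<close> and scale it down elsewhere. This
  costs relative entropy at most \<open>2 q\<close>, but a coupling has to bring mass at least \<open>q / 2\<close>
  from the left of \<open>a\<close> to the right of \<open>b\<close>, which costs \<open>(b - a)\<^sup>2 q / 2\<close>; the ratio is
  unbounded (lemma \<open>bottlenecked_not_T2_inequality\<close>).

  For the log-Sobolev inequality, take a smooth bump \<open>u\<close> with \<open>0 \<le> u \<le> 1\<close> and a universal
  bound on \<open>\<bar>u'\<bar>\<close>, supported in \<open>[a, R]\<close> and bounded below on most of \<open>(b, \<infinity>)\<close>. The
  energy of \<open>u\<close> is at most of order \<open>q\<close>, and its squared norm is exactly of order \<open>q\<close>, so after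
  normalisation the energy is bounded whereas the entropy is at least \<open>ln (1 / q) - O(1)\<close>, which tends to infinity
  (lemma \<open>bottlenecked_not_satisfies_LSI\<close>).\<close>

section \<open>Bottlenecks at infinity\<close>

text \<open>The smallness of \<open>\<nu> {b<..}\<close> expresses that the bottlenecks recede to infinity; the
  factor \<open>1 / 2\<close> could be any positive constant below \<open>1\<close>.\<close>

definition bottlenecked :: "real measure \<Rightarrow> bool" where
  "bottlenecked \<nu> \<longleftrightarrow> (\<forall>L>0. \<forall>\<epsilon>>0. \<exists>a b. b - a \<ge> L \<and> 0 < measure \<nu> {b<..} \<and>
     measure \<nu> {b<..} < \<epsilon> \<and> measure \<nu> {a..b} \<le> measure \<nu> {b<..} / 2)"

section \<open>Failure of the transport inequality\<close>

text \<open>Under any coupling of \<open>\<mu>\<close> and \<open>\<nu>\<close>, the part of \<open>\<mu>\<close> to the right of \<open>b\<close> that cannot be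
  matched with mass of \<open>\<nu>\<close> to the right of \<open>a\<close> has to travel at least \<open>b - a\<close>.\<close>

lemma W2_squared_ge_tail_surplus:
  assumes "real_distribution \<mu>" "real_distribution \<nu>" "a \<le> b"
  shows "ennreal ((b - a)\<^sup>2 * (measure \<mu> {b<..} - measure \<nu> {a..})) \<le> W2_squared \<mu> \<nu>"
  unfolding W2_squared_def
proof (rule INF_greatest)
  fix \<gamma> assume "\<gamma> \<in> couplings \<mu> \<nu>"
  then have prob: "prob_space \<gamma>" and sets[measurable_cong]: "sets \<gamma> = sets (borel \<Otimes>\<^sub>M borel)"
    and fst: "distr \<gamma> borel fst = \<mu>" and snd: "distr \<gamma> borel snd = \<nu>"
    by (auto simp: couplings_def)
  interpret prob_space \<gamma> by fact
  have space: "space \<gamma> = UNIV"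
    using sets_eq_imp_space_eq[OF sets] by (simp add: space_pair_measure)
  let ?X = "{w \<in> space \<gamma>. fst w > b}" and ?Y = "{w \<in> space \<gamma>. snd w \<ge> a}"
  have [measurable]: "?X \<in> sets \<gamma>" "?Y \<in> sets \<gamma>" by measurable
  have X: "prob ?X = measure \<mu> {b<..}"
    unfolding fst[symmetric] by (subst measure_distr) (auto intro!: arg_cong[where f=prob])
  have Y: "prob ?Y = measure \<nu> {a..}"
    unfolding snd[symmetric] by (subst measure_distr) (auto intro!: arg_cong[where f=prob])
  have "measure \<mu> {b<..} - measure \<nu> {a..} = prob ?X - prob ?Y" by (simp add: X Y)
  also have "prob ?X \<le> prob ((?X - ?Y) \<union> ?Y)"
    by (intro finite_measure_mono) auto
  then have "prob ?X - prob ?Y \<le> prob (?X - ?Y)"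
    using measure_Un_le[of "?X - ?Y" \<gamma> ?Y] by auto
  finally have surplus: "measure \<mu> {b<..} - measure \<nu> {a..} \<le> prob (?X - ?Y)" .
  have "ennreal ((b - a)\<^sup>2 * (measure \<mu> {b<..} - measure \<nu> {a..}))
      \<le> ennreal ((b - a)\<^sup>2 * prob (?X - ?Y))"
    using surplus by (intro ennreal_leI mult_left_mono) auto
  also have "\<dots> = ennreal ((b - a)\<^sup>2) * emeasure \<gamma> (?X - ?Y)"
    by (simp add: ennreal_mult emeasure_eq_measure)
  also have "\<dots> = (\<integral>\<^sup>+w. ennreal ((b - a)\<^sup>2) * indicator (?X - ?Y) w \<partial>\<gamma>)"
    by (subst nn_integral_cmult_indicator) auto
  also have "\<dots> \<le> (\<integral>\<^sup>+(x, y). ennreal (\<bar>x - y\<bar>\<^sup>2) \<partial>\<gamma>)"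
    using \<open>a \<le> b\<close>
    by (intro nn_integral_mono)
       (auto simp: indicator_def intro!: ennreal_leI power_mono split: prod.splits)
  finally show "ennreal ((b - a)\<^sup>2 * (measure \<mu> {b<..} - measure \<nu> {a..}))
      \<le> (\<integral>\<^sup>+(x, y). ennreal (\<bar>x - y\<bar>\<^sup>2) \<partial>\<gamma>)" .
qed

text \<open>The competitor for the transport inequality: its density with respect to \<open>\<nu>\<close> is \<open>2\<close> on the
  tail and the constant \<open>(1 - 2 q) / (1 - q)\<close> elsewhere. Moving a mass \<open>q\<close> in this
  proportional way has relative entropy of order \<open>q\<close>, with no factor \<open>ln (1 / q)\<close>.\<close>

lemma exists_double_tail:
  assumes "real_distribution \<nu>" and q: "0 < measure \<nu> {b<..}" "measure \<nu> {b<..} < 1/2"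
  obtains Q d where "real_distribution Q" "measure Q {b<..} = 2 * measure \<nu> {b<..}"
    "D_KL Q \<nu> = ereal d" "\<bar>d\<bar> \<le> 2 * measure \<nu> {b<..}"
proof -
  interpret real_distribution \<nu> by fact
  define q where "q = measure \<nu> {b<..}"
  define c where "c = (1 - 2 * q) / (1 - q)"
  define g where "g x = (if x > b then 2 else c)" for x
  define Q where "Q = density \<nu> (\<lambda>x. ennreal (g x))"
  have qb: "0 < q" "q < 1/2" using q by (auto simp: q_def)
  have c: "0 < c" "c < 1" "(1 - q) * c = 1 - 2 * q" using qb by (auto simp: c_def field_simps)
  have g0: "g x \<ge> 0" for x using c by (auto simp: g_def)
  have [measurable]: "g \<in> borel_measurable borel" unfolding g_def by measurable
  have compl: "measure \<nu> {..b} = 1 - q"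
    using prob_compl[of "{b<..}"] by (simp add: q_def Compl_eq_Diff_UNIV[symmetric] )
  have eQ: "emeasure Q {b<..} = ennreal (2 * q)" "emeasure Q {..b} = ennreal (1 - 2 * q)"
  proof -
    have "emeasure Q {b<..} = (\<integral>\<^sup>+x. ennreal 2 * indicator {b<..} x \<partial>\<nu>)"
      unfolding Q_def by (subst emeasure_density) (auto simp: g_def intro!: nn_integral_cong split: split_indicator)
    then show "emeasure Q {b<..} = ennreal (2 * q)"
      by (subst (asm) nn_integral_cmult_indicator)
         (auto simp: emeasure_eq_measure q_def ennreal_mult)
    have "emeasure Q {..b} = (\<integral>\<^sup>+x. ennreal c * indicator {..b} x \<partial>\<nu>)"
      unfolding Q_def by (subst emeasure_density) (auto simp: g_def intro!: nn_integral_cong split: split_indicator)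
    also have "\<dots> = ennreal (c * (1 - q))"
      using c qb by (subst nn_integral_cmult_indicator)
         (auto simp: emeasure_eq_measure compl ennreal_mult)
    finally show "emeasure Q {..b} = ennreal (1 - 2 * q)"
      using c by (simp add: mult.commute)
  qed
  have prob: "prob_space Q"
  proof
    have "emeasure Q (space Q) = emeasure Q ({b<..} \<union> {..b})"
      by (auto simp: Q_def intro!: arg_cong2[where f=emeasure])
    also have "\<dots> = emeasure Q {b<..} + emeasure Q {..b}"
      by (intro plus_emeasure[symmetric]) (auto simp: Q_def)
    finally show "emeasure Q (space Q) = 1"
      using qb by (simp add: eQ ennreal_plus[symmetric] del: ennreal_plus)
  qed
  have rQ: "real_distribution Q"
    by (intro real_distribution.intro prob real_distribution_axioms.intro) (auto simp: Q_def)
  have "AE x in \<nu>. ennreal (g x) = RN_deriv \<nu> Q x"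
    by (rule RN_deriv_unique) (simp_all add: Q_def)
  then have RN: "AE x in \<nu>. enn2real (RN_deriv \<nu> Q x) = g x"
    by eventually_elim (metis enn2real_ennreal g0)
  define h where "h x = 2 * ln 2 * indicator {b<..} x + c * ln c * indicator {..b} x" for x :: real
  have AEh: "AE x in \<nu>. enn2real (RN_deriv \<nu> Q x) * ln (enn2real (RN_deriv \<nu> Q x)) = h x"
    using RN by eventually_elim (auto simp: h_def g_def)
  have ind: "has_bochner_integral \<nu> (indicator A) (prob A)" if "A \<in> sets borel" for A
    using that by (intro has_bochner_integral_real_indicator) (auto simp: emeasure_eq_measure)
  have h: "has_bochner_integral \<nu> h (2 * ln 2 * q + c * ln c * (1 - q))"
    unfolding h_def q_def compl[symmetric, unfolded q_def]
    by (intro has_bochner_integral_add has_bochner_integral_mult_right ind) auto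
  define d where "d = 2 * ln 2 * q + (1 - 2 * q) * ln c"
  have KL: "D_KL Q \<nu> = ereal d"
  proof -
    have "absolutely_continuous \<nu> Q" unfolding Q_def by (intro absolutely_continuousI_density) auto
    moreover have "2 * ln 2 * q + c * ln c * (1 - q) = d"
      by (simp add: d_def c(3)[symmetric])
    then have "has_bochner_integral \<nu> (\<lambda>x. enn2real (RN_deriv \<nu> Q x) * ln (enn2real (RN_deriv \<nu> Q x))) d"
      using h by (subst has_bochner_integral_cong_AE[OF _ _ AEh]) (auto simp: h_def)
    ultimately show ?thesis
      unfolding D_KL_def Let_def using has_bochner_integral_iff by metis
  qed
  \<comment> \<open>The two terms of \<open>d\<close> have opposite signs: the first lies in \<open>[0, 2 q]\<close> and the second
    in \<open>[- q, 0]\<close>.\<close>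
  have "ln c \<le> 0" using c by simp
  then have "(1 - 2 * q) * ln c \<le> 0" using qb by (intro mult_nonneg_nonpos) auto
  moreover have "ln (2::real) \<le> 1" using ln_2_less_1 by simp
  then have "2 * ln 2 * q \<le> 2 * q" using qb by simp
  moreover have "- ln c \<le> 1 / c - 1"
    using ln_le_minus_one[of "1 / c"] c by (simp add: ln_div)
  then have "(1 - 2 * q) * (- ln c) \<le> (1 - 2 * q) * (1 / c - 1)" using qb by (intro mult_left_mono) auto
  moreover have "(1 - 2 * q) * (1 / c - 1) = q" using qb by (simp add: c_def field_simps)
  moreover have "2 * ln 2 * q \<ge> 0" using qb by simp
  ultimately have "\<bar>d\<bar> \<le> 2 * q" unfolding d_def by linarith
  with that[OF rQ _ KL] show ?thesis using eQ(1) qb by (simp add: q_def[symmetric] measure_def[of Q])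
qed

text \<open>Doubling the tail costs entropy at most \<open>2 q\<close> but transport at least \<open>(b - a)\<^sup>2 q / 2\<close>,
  because only \<open>3 q / 2\<close> of the mass \<open>2 q\<close> now beyond \<open>b\<close> can come from the right of \<open>a\<close>.\<close>

lemma bottlenecked_not_T2_inequality:
  assumes \<nu>: "real_distribution \<nu>" and "bottlenecked \<nu>"
  shows "\<not> T2_inequality \<nu> C"
proof
  assume T2: "T2_inequality \<nu> C"
  interpret real_distribution \<nu> by fact
  \<comment> \<open>Any length \<open>L\<close> with \<open>L\<^sup>2 > 4 * \<bar>C\<bar>\<close> would do.\<close>
  obtain a b where ab: "2 * \<bar>C\<bar> + 3 \<le> b - a" and q: "0 < measure \<nu> {b<..}" "measure \<nu> {b<..} < 1 / 2"
    and gap: "measure \<nu> {a..b} \<le> measure \<nu> {b<..} / 2"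
    using assms(2) unfolding bottlenecked_def
    by (metis abs_ge_zero add_nonneg_pos half_gt_zero mult_nonneg_nonneg zero_le_numeral zero_less_numeral zero_less_one)
  obtain Q d where Q: "real_distribution Q" "measure Q {b<..} = 2 * measure \<nu> {b<..}"
    and KL: "D_KL Q \<nu> = ereal d" "\<bar>d\<bar> \<le> 2 * measure \<nu> {b<..}"
    using exists_double_tail[OF \<nu> q] .
  define q where "q = measure \<nu> {b<..}"
  have "measure \<nu> {a..} \<le> measure \<nu> {a..b} + measure \<nu> {b<..}"
    using measure_Un_le[of "{a..b}" \<nu> "{b<..}"] ab by (simp add: ivl_disj_un)
  then have tail: "q / 2 \<le> measure Q {b<..} - measure \<nu> {a..}" using gap Q(2) by (simp add: q_def)
  have "ennreal ((b - a)\<^sup>2 * (q / 2)) \<le> ennreal ((b - a)\<^sup>2 * (measure Q {b<..} - measure \<nu> {a..}))"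
    using tail by (intro ennreal_leI mult_left_mono) auto
  also have "\<dots> \<le> W2_squared Q \<nu>"
    using ab by (intro W2_squared_ge_tail_surplus Q \<nu>) auto
  finally have "enn2ereal (ennreal ((b - a)\<^sup>2 * (q / 2))) \<le> enn2ereal (W2_squared Q \<nu>)"
    by (simp add: less_eq_ennreal.rep_eq)
  also have "\<dots> \<le> ereal C * D_KL Q \<nu>" using T2 Q by (auto simp: T2_inequality_def)
  finally have "(b - a)\<^sup>2 * (q / 2) \<le> C * d"
    using measure_nonneg[of \<nu> "{b<..}"] by (simp add: KL q_def enn2ereal_ennreal)
  also have "C * d \<le> \<bar>C\<bar> * (2 * q)"
    using KL(2) by (metis abs_ge_self abs_ge_zero abs_mult mult_left_mono order_trans q_def)
  finally have "(b - a)\<^sup>2 * q \<le> (4 * \<bar>C\<bar>) * q" by simp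
  then have "(b - a)\<^sup>2 \<le> 4 * \<bar>C\<bar>" using q by (simp add: q_def)
  moreover have "(2 * \<bar>C\<bar> + 3)\<^sup>2 \<le> (b - a)\<^sup>2" using ab by (intro power_mono) auto
  moreover have "(2 * \<bar>C\<bar> + 3)\<^sup>2 = 4 * (\<bar>C\<bar> * \<bar>C\<bar>) + 12 * \<bar>C\<bar> + 9"
    by (simp add: power2_eq_square algebra_simps)
  moreover have "0 \<le> \<bar>C\<bar> * \<bar>C\<bar>" by simp
  ultimately show False using abs_ge_zero[of C] by linarith
qed

section \<open>Smooth bump functions\<close>

text \<open>For \<open>p = 1\<close> this is the standard smooth function that is flat at \<open>0\<close>. The polynomial factor
  makes the family closed under differentiation.\<close>

definition flat :: "real poly \<Rightarrow> real \<Rightarrow> real" where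
  "flat p x = (if x > 0 then poly p (1 / x) * exp (- (1 / x)) else 0)"

lemma poly_times_exp_minus_tendsto_0:
  fixes p :: "real poly"
  shows "((\<lambda>x. poly p x * exp (- x)) \<longlongrightarrow> 0) at_top"
proof -
  have "((\<lambda>x. \<Sum>i\<le>degree p. coeff p i * (x ^ i / exp x)) \<longlongrightarrow> (\<Sum>i\<le>degree p. coeff p i * 0)) at_top"
    by (intro tendsto_intros tendsto_power_div_exp_0)
  then show ?thesis
    by (simp add: poly_altdef exp_minus divide_inverse sum_distrib_right mult.assoc)
qed

lemma flat_tendsto_0: "(flat p \<longlongrightarrow> 0) (at 0)"
proof (rule filterlim_split_at_real)
  show "(flat p \<longlongrightarrow> 0) (at_left 0)"
    by (rule tendsto_eventually) (auto simp: eventually_at_left_field flat_def intro!: exI[of _ "-1"])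
  have "((\<lambda>x. flat p (inverse x)) \<longlongrightarrow> 0) at_top"
    by (rule Lim_transform_eventually[OF poly_times_exp_minus_tendsto_0[of p]])
       (use eventually_gt_at_top[of 0] in eventually_elim, simp add: flat_def divide_inverse)
  then show "(flat p \<longlongrightarrow> 0) (at_right 0)"
    by (simp add: filterlim_at_right_to_top)
qed

text \<open>At \<open>0\<close>, the difference quotient of \<^term>\<open>flat p\<close> is \<^term>\<open>flat (pCons 0 p)\<close>, so it tends
  to \<open>0\<close> by the previous lemma.\<close>

lemma flat_has_real_derivative:
  "(flat p has_real_derivative flat ([:0, 0, 1:] * (p - pderiv p)) x) (at x)"
proof (cases x "0 :: real" rule: linorder_cases)
  case less
  have "((\<lambda>_. 0) has_real_derivative 0) (at x)" by simp
  then have "(flat p has_real_derivative 0) (at x)"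
    by (rule has_field_derivative_transform_within_open[of _ _ _ "{..<0}"]) (use less in \<open>auto simp: flat_def\<close>)
  then show ?thesis using less by (simp add: flat_def)
next
  case equal
  have "(flat (pCons 0 p) \<longlongrightarrow> 0) (at 0)" by (rule flat_tendsto_0)
  then have "((\<lambda>y. (flat p y - flat p 0) / (y - 0)) \<longlongrightarrow> 0) (at 0)"
    by (rule Lim_transform_eventually)
       (auto simp: flat_def eventually_at_filter)
  then show ?thesis using equal by (simp add: has_field_derivative_iff flat_def)
next
  case greater
  have "((\<lambda>x. poly p (1 / x) * exp (- (1 / x))) has_real_derivative
     (poly (pderiv p) (1 / x) * (- (1 / x\<^sup>2))) * exp (- (1 / x))
       + (exp (- (1 / x)) * (1 / x\<^sup>2)) * poly p (1 / x)) (at x)"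
    using greater
    by (auto intro!: derivative_eq_intros poly_DERIV[THEN DERIV_chain2] simp: power2_eq_square)
  then have "(flat p has_real_derivative
     (poly (pderiv p) (1 / x) * (- (1 / x\<^sup>2))) * exp (- (1 / x))
       + (exp (- (1 / x)) * (1 / x\<^sup>2)) * poly p (1 / x)) (at x)"
    by (rule has_field_derivative_transform_within_open[of _ _ _ "{0<..}"]) (use greater in \<open>auto simp: flat_def\<close>)
  then show ?thesis
    by (rule DERIV_cong) (use greater in \<open>simp add: flat_def power2_eq_square algebra_simps\<close>)
qed

text \<open>The affine substitutions and the products are what the bump function needs; sums come in with
  the product rule. Being closed under derivatives, all functions of this class are smooth, so
  no formula for iterated derivatives is required.\<close>

inductive flat_algebra :: "(real \<Rightarrow> real) \<Rightarrow> bool" where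
  affine: "flat_algebra (\<lambda>x. flat p (c * x + d))"
| add: "flat_algebra f \<Longrightarrow> flat_algebra g \<Longrightarrow> flat_algebra (\<lambda>x. f x + g x)"
| mult: "flat_algebra f \<Longrightarrow> flat_algebra g \<Longrightarrow> flat_algebra (\<lambda>x. f x * g x)"

lemma flat_algebra_derivative:
  assumes "flat_algebra f"
  shows "\<exists>f'. flat_algebra f' \<and> (\<forall>x. (f has_real_derivative f' x) (at x))"
  using assms
proof induction
  case (affine p c d)
  let ?p' = "[:0, 0, 1:] * (p - pderiv p)"
  have "((\<lambda>x. flat p (c * x + d)) has_real_derivative flat ?p' (c * x + d) * c) (at x)" for x
    by (rule DERIV_chain2[OF flat_has_real_derivative]) (auto intro!: derivative_eq_intros)
  moreover have "flat ?p' (c * x + d) * c = flat (smult c ?p') (c * x + d)" for x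
    by (simp add: flat_def)
  ultimately show ?case using flat_algebra.affine by metis
next
  case (add f g)
  then obtain f' g' where "flat_algebra f'" "flat_algebra g'"
    "\<And>x. (f has_real_derivative f' x) (at x)" "\<And>x. (g has_real_derivative g' x) (at x)"
    by blast
  then show ?case
    by (intro exI[of _ "\<lambda>x. f' x + g' x"] conjI allI flat_algebra.add DERIV_add)
next
  case (mult f g)
  then obtain f' g' where "flat_algebra f'" "flat_algebra g'"
    "\<And>x. (f has_real_derivative f' x) (at x)" "\<And>x. (g has_real_derivative g' x) (at x)"
    by blast
  then show ?case using mult.hyps
    by (intro exI[of _ "\<lambda>x. f' x * g x + g' x * f x"] conjI allI
          flat_algebra.add flat_algebra.mult DERIV_mult)
qed

lemma flat_algebra_deriv:
  assumes "flat_algebra f"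
  shows "flat_algebra (deriv f)" "(f has_real_derivative deriv f x) (at x)"
proof -
  obtain f' where f': "flat_algebra f'" "\<And>x. (f has_real_derivative f' x) (at x)"
    using flat_algebra_derivative[OF assms] by blast
  then have "deriv f = f'" by (auto intro: DERIV_imp_deriv)
  with f' show "flat_algebra (deriv f)" "(f has_real_derivative deriv f x) (at x)" by auto
qed

lemma flat_algebra_smooth:
  assumes "flat_algebra f"
  shows "smooth f"
proof -
  have "flat_algebra ((deriv ^^ n) f)" for n
    by (induction n) (auto simp: assms flat_algebra_deriv)
  then show ?thesis
    unfolding smooth_def using flat_algebra_deriv(2) real_differentiable_def by blast
qed

lemma flat_algebra_borel_measurable:
  assumes "flat_algebra f"
  shows "f \<in> borel_measurable borel"
  using flat_algebra_deriv(2)[OF assms]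
  by (intro borel_measurable_continuous_onI continuous_at_imp_continuous_on ballI DERIV_isCont) auto

lemma flat_1_bounds: "0 \<le> flat 1 x" "flat 1 x \<le> 1" "1 \<le> x \<Longrightarrow> exp (-1) \<le> flat 1 x"
  by (auto simp: flat_def)

lemma abs_deriv_flat_1: "\<bar>flat [:0, 0, 1:] x\<bar> \<le> 2"
proof (cases "x > 0")
  case True
  define y where "y = 1 / x"
  have "y > 0" using True by (simp add: y_def)
  then have "y\<^sup>2 \<le> 2 * exp y" using exp_lower_Taylor_quadratic[of y] by simp
  then have "y\<^sup>2 * exp (- y) \<le> 2" by (simp add: exp_minus field_simps)
  then show ?thesis using True \<open>y > 0\<close>
    by (simp add: flat_def y_def[symmetric] power2_eq_square)
qed (simp add: flat_def)

text \<open>A multiple of the product of two flat functions facing each other, vanishing outside \<open>[a, R]\<close>.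
  There is no plateau: on \<open>[a + 1, R - 1]\<close> a bump with \<open>s = 1\<close> is at least \<open>exp (-2)\<close>, and
  that suffices. The right-hand side is spelled as a product of two generators of
  \<^const>\<open>flat_algebra\<close>.\<close>

definition bump :: "real \<Rightarrow> real \<Rightarrow> real \<Rightarrow> real \<Rightarrow> real" where
  "bump s a R x = flat [:s:] (1 * x + (- a)) * flat 1 ((-1) * x + R)"

lemma bump_altdef: "bump s a R x = s * (flat 1 (x - a) * flat 1 (R - x))"
  by (simp add: bump_def flat_def)

lemma flat_algebra_bump: "flat_algebra (bump s a R)"
  unfolding bump_def[abs_def] by (intro flat_algebra.intros)

lemma bump_eq_0: "x \<notin> {a..R} \<Longrightarrow> bump s a R x = 0"
  by (auto simp: bump_altdef flat_def)

lemma deriv_bump_eq_0: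
  assumes "x \<notin> {a..R}" shows "deriv (bump s a R) x = 0"
proof (rule DERIV_imp_deriv)
  have "((\<lambda>_. 0) has_real_derivative 0) (at x)" by simp
  then show "(bump s a R has_real_derivative 0) (at x)"
    by (rule has_field_derivative_transform_within_open[of _ _ _ "- {a..R}"])
       (use assms in \<open>auto simp: bump_eq_0\<close>)
qed

lemma compactly_supported_bump: "compactly_supported (bump s a R)"
  unfolding compactly_supported_def compact_closure
  by (rule bounded_subset[OF bounded_closed_interval[of a R]]) (use bump_eq_0[of _ a R s] in blast)

text \<open>The bound does not depend on the length of the support, so the energy of a bump is controlled
  by the mass of its support alone.\<close>

lemma abs_deriv_bump:
  assumes "0 \<le> s" shows "\<bar>deriv (bump s a R) x\<bar> \<le> 4 * s"
proof -
  let ?d = "flat [:0, 0, 1:]"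
  have d: "(flat 1 has_real_derivative ?d x) (at x)" for x
    using flat_has_real_derivative[of 1 x] by (simp add: pderiv_1)
  have "(bump s a R has_real_derivative
      s * (?d (x - a) * 1 * flat 1 (R - x) + ?d (R - x) * (-1) * flat 1 (x - a))) (at x)"
    unfolding bump_altdef[abs_def]
    by (intro DERIV_cmult DERIV_mult DERIV_chain2[OF d]) (auto intro!: derivative_eq_intros)
  then have "\<bar>deriv (bump s a R) x\<bar> =
      \<bar>s * (?d (x - a) * flat 1 (R - x) - ?d (R - x) * flat 1 (x - a))\<bar>"
    by (subst DERIV_imp_deriv) auto
  also have "\<dots> = s * \<bar>?d (x - a) * flat 1 (R - x) - ?d (R - x) * flat 1 (x - a)\<bar>"
    using assms by (simp add: abs_mult)
  also have "\<dots> \<le> s * (\<bar>?d (x - a)\<bar> * \<bar>flat 1 (R - x)\<bar> + \<bar>?d (R - x)\<bar> * \<bar>flat 1 (x - a)\<bar>)"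
    using assms abs_triangle_ineq4 by (intro mult_left_mono) (auto simp flip: abs_mult)
  also have "\<dots> \<le> s * (2 * 1 + 2 * 1)"
    using assms abs_deriv_flat_1 flat_1_bounds
    by (intro mult_left_mono add_mono mult_mono) auto
  finally show ?thesis by simp
qed

section \<open>Failure of the log-Sobolev inequality\<close>

lemma mult_ln_bounds:
  fixes t :: real assumes "0 \<le> t" shows "-1 \<le> t * ln t" "t * ln t \<le> t\<^sup>2"
proof -
  show "-1 \<le> t * ln t"
  proof (cases "t = 0")
    case False
    with assms have "ln (1 / t) \<le> 1 / t - 1" by (intro ln_le_minus_one) auto
    then have "t * (1 - 1 / t) \<le> t * ln t"
      using False assms by (intro mult_left_mono) (auto simp: ln_div)
    then show ?thesis using False assms by (simp add: algebra_simps)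
  qed simp
  show "t * ln t \<le> t\<^sup>2"
    using ln_le_minus_one[of t] assms unfolding power2_eq_square
    by (cases "t = 0") (auto intro!: mult_left_mono)
qed

text \<open>The test function is a bump over \<open>[a, R]\<close>, normalised in \<open>L\<^sup>2 (\<nu>)\<close>. Its squared norm \<open>N\<close>
  before normalisation is comparable to the tail mass \<open>q\<close>: it is at most
  \<open>\<nu> [a, \<infinity>) \<le> 2 q\<close>, and at least \<open>q\<close> times a universal constant if \<open>R\<close> is large. The energy
  is therefore bounded by a universal constant, while the term \<open>- ln N\<close> in the entropy grows
  without bound as \<open>q\<close> tends to \<open>0\<close>.\<close>

lemma bottlenecked_not_satisfies_LSI:
  assumes \<nu>: "real_distribution \<nu>" and bott: "bottlenecked \<nu>"
  shows "\<not> satisfies_LSI \<nu>"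
proof
  assume "satisfies_LSI \<nu>"
  then obtain C where LSI: "\<And>f. smooth f \<Longrightarrow> compactly_supported f \<Longrightarrow> (\<integral>x. (f x)\<^sup>2 \<partial>\<nu>) = 1 \<Longrightarrow>
      (\<integral>x. (f x)\<^sup>2 * ln ((f x)\<^sup>2) \<partial>\<nu>) \<le> C * (\<integral>x. \<bar>deriv f x\<bar>\<^sup>2 \<partial>\<nu>)"
    unfolding satisfies_LSI_def by auto
  interpret real_distribution \<nu> by fact
  \<comment> \<open>\<open>1 / M\<close> bounds the squared bump from below on \<open>[a + 1, R - 1]\<close>. The tail mass is then
    chosen so small that its logarithm beats all other contributions.\<close>
  define M :: real where "M = exp 4"
  have M: "M > 0" by (simp add: M_def)
  obtain a b where ab: "1 \<le> b - a" and q0: "0 < measure \<nu> {b<..}"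
    and small: "measure \<nu> {b<..} < exp (- (4 * M + 64 * M * \<bar>C\<bar>)) / 2"
    and gap: "measure \<nu> {a..b} \<le> measure \<nu> {b<..} / 2"
    using bott[unfolded bottlenecked_def, rule_format, of 1 "exp (- (4 * M + 64 * M * \<bar>C\<bar>)) / 2"] by auto
  define q where "q = measure \<nu> {b<..}"
  have q: "0 < q" using q0 by (simp add: q_def)
  have tail: "measure \<nu> {a..} \<le> 2 * q"
    using measure_Un_le[of "{a..b}" \<nu> "{b<..}"] ab gap q by (simp add: ivl_disj_un q_def)
  obtain R where R: "measure \<nu> {b<..R - 1} \<ge> q / 2"
  proof -
    have "cdf \<nu> b = 1 - q"
      using prob_compl[of "{b<..}"] by (simp add: q_def cdf_def Compl_eq_Diff_UNIV[symmetric])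
    moreover have "\<forall>\<^sub>F x in at_top. 1 - q / 2 < cdf \<nu> x"
      using cdf_lim_at_top_prob q by (intro order_tendstoD) auto
    with eventually_gt_at_top[of b] have "\<forall>\<^sub>F x in at_top. 1 - q / 2 < cdf \<nu> x \<and> b < x"
      by eventually_elim auto
    then obtain x where "1 - q / 2 < cdf \<nu> x" "b < x"
      using eventually_happens'[OF trivial_limit_at_top_linorder] by blast
    ultimately show ?thesis using cdf_diff_eq[of b x] that[of "x + 1"] by simp
  qed
  define u where "u = bump 1 a R"
  have u01: "0 \<le> u x" "u x \<le> 1" for x
    unfolding u_def bump_altdef using flat_1_bounds by (auto intro!: mult_le_one mult_nonneg_nonneg)
  have [measurable]: "bump s a R \<in> borel_measurable borel" "deriv (bump s a R) \<in> borel_measurable borel" for s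
    by (intro flat_algebra_borel_measurable flat_algebra_deriv flat_algebra_bump)+
  have [measurable]: "u \<in> borel_measurable borel" by (simp add: u_def)
  define N where "N = (\<integral>x. (u x)\<^sup>2 \<partial>\<nu>)"
  have bounded_integrable: "integrable \<nu> f" if "f \<in> borel_measurable borel" "\<And>x. \<bar>f x\<bar> \<le> B" for f :: "real \<Rightarrow> real" and B
    using that by (intro integrable_const_bound[of _ B]) auto
  have intu: "integrable \<nu> (\<lambda>x. (u x)\<^sup>2)"
    using u01 by (intro bounded_integrable[of _ 1]) (auto simp: power_le_one)
  have inda: "integrable \<nu> (\<lambda>x. c * indicator {a..} x)" for c :: real
    by (intro integrable_mult_right integrable_real_indicator) (auto simp: emeasure_eq_measure)
  have intind: "(\<integral>x. c * indicator A x \<partial>\<nu>) = c * prob A" if "A \<in> sets borel" for c :: real and A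
    using that by (simp add: emeasure_eq_measure)
  have N_le: "N \<le> 2 * q"
  proof -
    have "N \<le> (\<integral>x. 1 * indicator {a..} x \<partial>\<nu>)"
      unfolding N_def using intu inda[of 1] u01 bump_eq_0[of _ a R 1]
      by (intro integral_mono) (auto simp: power_le_one u_def indicator_def)
    then show ?thesis using tail intind[of "{a..}" 1] by simp
  qed
  have N_ge: "q / (2 * M) \<le> N"
  proof -
    have "(1 / M) * indicator {b<..R - 1} x \<le> (u x)\<^sup>2" for x
    proof (cases "x \<in> {b<..R - 1}")
      case True
      then have "exp (-1) * exp (-1) \<le> flat 1 (x - a) * flat 1 (R - x)"
        using ab by (intro mult_mono flat_1_bounds) auto
      then have "(exp (-1) * exp (-1))\<^sup>2 \<le> (u x)\<^sup>2"
        by (intro power_mono) (auto simp: u_def bump_altdef)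
      moreover have "(exp (-1) * exp (-1 :: real))\<^sup>2 = 1 / M"
        by (simp add: M_def power2_eq_square exp_minus field_simps flip: exp_add)
      ultimately show ?thesis using True by simp
    qed simp
    then have "(\<integral>x. (1 / M) * indicator {b<..R - 1} x \<partial>\<nu>) \<le> N"
      unfolding N_def using intu
      by (intro integral_mono integrable_mult_right integrable_real_indicator) (auto simp: emeasure_eq_measure)
    moreover have "(\<integral>x. (1 / M) * indicator {b<..R - 1} x \<partial>\<nu>) = (1 / M) * prob {b<..R - 1}"
      by (intro intind) auto
    moreover have "(1 / M) * (q / 2) \<le> (1 / M) * prob {b<..R - 1}"
      using R M by (intro mult_left_mono) auto
    ultimately show ?thesis by (simp add: field_simps)
  qed
  have N: "N > 0" using N_ge q M by (smt (verit) divide_pos_pos)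
  define s where "s = 1 / sqrt N"
  have s: "s \<ge> 0" "s\<^sup>2 = 1 / N" using N by (auto simp: s_def power_divide)
  define f where "f = bump s a R"
  have f2: "(f x)\<^sup>2 = (u x)\<^sup>2 / N" for x
    using s by (simp add: f_def u_def bump_altdef power_mult_distrib)
  have tail_N: "measure \<nu> {a..} / N \<le> 4 * M"
  proof -
    have "q \<le> 2 * M * N" using N_ge M by (simp add: field_simps)
    then show ?thesis using tail N by (simp add: field_simps)
  qed
  have "(\<integral>x. (f x)\<^sup>2 \<partial>\<nu>) = 1" using N by (simp add: f2 N_def[symmetric])
  then have ineq: "(\<integral>x. (f x)\<^sup>2 * ln ((f x)\<^sup>2) \<partial>\<nu>) \<le> C * (\<integral>x. \<bar>deriv f x\<bar>\<^sup>2 \<partial>\<nu>)"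
    unfolding f_def
    by (intro LSI flat_algebra_smooth flat_algebra_bump compactly_supported_bump)
  have energy: "(\<integral>x. \<bar>deriv f x\<bar>\<^sup>2 \<partial>\<nu>) \<le> 64 * M"
  proof -
    have bd: "\<bar>deriv f x\<bar>\<^sup>2 \<le> 16 / N" for x
    proof -
      have "\<bar>deriv f x\<bar>\<^sup>2 \<le> (4 * s)\<^sup>2"
        unfolding f_def by (intro power_mono abs_deriv_bump s) auto
      then show ?thesis using s by (simp add: power_mult_distrib)
    qed
    have "(\<integral>x. \<bar>deriv f x\<bar>\<^sup>2 \<partial>\<nu>) \<le> (\<integral>x. (16 / N) * indicator {a..} x \<partial>\<nu>)"
    proof (rule integral_mono[OF _ inda])
      show "integrable \<nu> (\<lambda>x. \<bar>deriv f x\<bar>\<^sup>2)"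
        using bd by (intro bounded_integrable[of _ "16 / N"]) (auto simp: f_def)
      show "\<bar>deriv f x\<bar>\<^sup>2 \<le> (16 / N) * indicator {a..} x" for x
        using bd[of x] deriv_bump_eq_0[of x a R s] by (auto simp: f_def indicator_def)
    qed
    then show ?thesis using tail_N by (simp add: intind)
  qed
  have entropy: "- 4 * M - ln (2 * q) \<le> (\<integral>x. (f x)\<^sup>2 * ln ((f x)\<^sup>2) \<partial>\<nu>)"
  proof -
    \<comment> \<open>With \<open>f\<^sup>2 = u\<^sup>2 / N\<close>, the entropy density is \<open>u\<^sup>2 ln (u\<^sup>2) / N - u\<^sup>2 ln N / N\<close>, and
      \<open>t ln t \<ge> -1\<close> controls the first term on the support of \<open>u\<close>.\<close>
    let ?h = "\<lambda>x. (- ln N / N) * (u x)\<^sup>2 + (- 1 / N) * indicator {a..} x"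
    have "(\<integral>x. ?h x \<partial>\<nu>) \<le> (\<integral>x. (f x)\<^sup>2 * ln ((f x)\<^sup>2) \<partial>\<nu>)"
    proof (rule integral_mono)
      show "integrable \<nu> ?h" by (intro Bochner_Integration.integrable_add integrable_mult_right intu inda)
      have "(f x)\<^sup>2 \<le> 1 / N" for x
        using u01[of x] N unfolding f2 by (intro divide_right_mono) (auto simp: power_le_one)
      then have "((f x)\<^sup>2)\<^sup>2 \<le> (1 / N)\<^sup>2" for x by (intro power_mono) auto
      then have "\<bar>(f x)\<^sup>2 * ln ((f x)\<^sup>2)\<bar> \<le> 1 + (1 / N)\<^sup>2" for x
        using mult_ln_bounds[of "(f x)\<^sup>2"] unfolding abs_le_iff
        by (smt (verit) zero_le_power2)
      then show "integrable \<nu> (\<lambda>x. (f x)\<^sup>2 * ln ((f x)\<^sup>2))"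
        by (rule bounded_integrable[rotated]) (auto simp: f_def)
      show "?h x \<le> (f x)\<^sup>2 * ln ((f x)\<^sup>2)" for x
      proof (cases "u x = 0")
        case True
        then show ?thesis using N by (simp add: f2 indicator_def)
      next
        case False
        then have "x \<in> {a..}" using bump_eq_0[of x a R 1] by (force simp: u_def)
        moreover have "-1 / N \<le> (u x)\<^sup>2 * ln ((u x)\<^sup>2) / N"
          using N mult_ln_bounds(1)[of "(u x)\<^sup>2"] by (intro divide_right_mono) auto
        moreover have "ln ((u x)\<^sup>2 / N) = ln ((u x)\<^sup>2) - ln N"
          using False N by (simp add: ln_div)
        moreover have "(u x)\<^sup>2 / N * (ln ((u x)\<^sup>2) - ln N)
            = (u x)\<^sup>2 * ln ((u x)\<^sup>2) / N + (- ln N / N) * (u x)\<^sup>2"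
          using N by (simp add: field_simps)
        ultimately show ?thesis unfolding f2 by simp
      qed
    qed
    moreover have "(\<integral>x. ?h x \<partial>\<nu>)
        = (\<integral>x. (- ln N / N) * (u x)\<^sup>2 \<partial>\<nu>) + (\<integral>x. (- 1 / N) * indicator {a..} x \<partial>\<nu>)"
      by (intro Bochner_Integration.integral_add integrable_mult_right intu inda)
    moreover have "(\<integral>x. (- ln N / N) * (u x)\<^sup>2 \<partial>\<nu>) = - ln N"
      unfolding Bochner_Integration.integral_mult_right_zero N_def[symmetric] using N by simp
    moreover have "(\<integral>x. (- 1 / N) * indicator {a..} x \<partial>\<nu>) = - (measure \<nu> {a..} / N)"
      by (subst intind) auto
    moreover have "ln N \<le> ln (2 * q)" using N N_le by simp
    ultimately show ?thesis using tail_N by linarith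
  qed
  have "C * (\<integral>x. \<bar>deriv f x\<bar>\<^sup>2 \<partial>\<nu>) \<le> \<bar>C\<bar> * (64 * M)"
    using energy by (intro mult_mono) auto
  moreover have "ln (2 * q) < ln (exp (- (4 * M + 64 * M * \<bar>C\<bar>)))"
    using small q by (subst ln_less_cancel_iff) (auto simp: q_def)
  ultimately show False using ineq entropy by (simp add: algebra_simps)
qed

section \<open>Normal measures\<close>

lemma sets_normal_measure [simp, measurable_cong]: "sets (normal_measure m s) = sets borel"
  by (simp add: normal_measure_def)

lemma space_normal_measure [simp]: "space (normal_measure m s) = UNIV"
  by (simp add: normal_measure_def)

lemma prob_space_normal_measure: "0 < s \<Longrightarrow> prob_space (normal_measure m s)"
  unfolding normal_measure_def by (rule prob_space_normal_density)

lemma nn_integral_normal_measure: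
  assumes "f \<in> borel_measurable borel"
  shows "(\<integral>\<^sup>+x. f x \<partial>normal_measure m s) = (\<integral>\<^sup>+x. ennreal (normal_density m s x) * f x \<partial>lborel)"
  using assms unfolding normal_measure_def by (subst nn_integral_density) auto

lemma distr_uminus_normal_measure:
  "distr (normal_measure 0 s) borel uminus = normal_measure 0 s"
proof (rule measure_eqI)
  fix A assume "A \<in> sets (distr (normal_measure 0 s) borel uminus)"
  then have [measurable]: "A \<in> sets borel" by simp
  have "emeasure (distr (normal_measure 0 s) borel uminus) A
      = (\<integral>\<^sup>+x. indicator A (- x) \<partial>normal_measure 0 s)"
    by (subst nn_integral_indicator[symmetric]) (simp, subst nn_integral_distr, auto)
  also have "\<dots> = (\<integral>\<^sup>+x. ennreal (normal_density 0 s x) * indicator A (- x) \<partial>lborel)"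
    by (subst nn_integral_normal_measure) auto
  also have "\<dots> = (\<integral>\<^sup>+x. ennreal (normal_density 0 s x) * indicator A x \<partial>lborel)"
    by (subst nn_integral_real_affine[of _ "-1" 0]) (auto simp: normal_density_def)
  also have "\<dots> = emeasure (normal_measure 0 s) A"
    by (simp add: normal_measure_def emeasure_density)
  finally show "emeasure (distr (normal_measure 0 s) borel uminus) A = emeasure (normal_measure 0 s) A" .
qed simp

text \<open>Shifting the tail to the origin costs the factor \<open>exp (- x\<^sup>2 / 2s\<^sup>2)\<close>, because
  \<open>(x + z)\<^sup>2 \<ge> x\<^sup>2 + z\<^sup>2\<close> for \<open>x, z \<ge> 0\<close>.\<close>

lemma normal_tail_le:
  assumes "0 < s" "0 \<le> x"
  shows "measure (normal_measure 0 s) {x..} \<le> exp (- (x\<^sup>2 / (2 * s\<^sup>2)))"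
proof -
  interpret prob_space "normal_measure 0 s" by (rule prob_space_normal_measure) fact
  have "emeasure (normal_measure 0 s) {x..} = (\<integral>\<^sup>+y. ennreal (normal_density 0 s y) * indicator {x..} y \<partial>lborel)"
    by (simp add: normal_measure_def emeasure_density)
  also have "\<dots> = (\<integral>\<^sup>+z. ennreal (normal_density 0 s (x + z)) * indicator {x..} (x + z) \<partial>lborel)"
    by (subst nn_integral_real_affine[of _ 1 x]) auto
  also have "\<dots> \<le> (\<integral>\<^sup>+z. ennreal (exp (- (x\<^sup>2 / (2 * s\<^sup>2)))) * ennreal (normal_density 0 s z) \<partial>lborel)"
  proof (intro nn_integral_mono)
    fix z
    show "ennreal (normal_density 0 s (x + z)) * indicator {x..} (x + z)
        \<le> ennreal (exp (- (x\<^sup>2 / (2 * s\<^sup>2)))) * ennreal (normal_density 0 s z)"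
    proof (cases "z \<ge> 0")
      case True
      have "- (x + z)\<^sup>2 / (2 * s\<^sup>2) \<le> - (x\<^sup>2 / (2 * s\<^sup>2)) + - z\<^sup>2 / (2 * s\<^sup>2)"
        using True assms by (simp add: field_simps power2_eq_square)
      then have "exp (- (x + z)\<^sup>2 / (2 * s\<^sup>2)) \<le> exp (- (x\<^sup>2 / (2 * s\<^sup>2))) * exp (- z\<^sup>2 / (2 * s\<^sup>2))"
        by (simp flip: exp_add)
      then have "normal_density 0 s (x + z) \<le> exp (- (x\<^sup>2 / (2 * s\<^sup>2))) * normal_density 0 s z"
        unfolding normal_density_def using assms(1) by (simp add: divide_right_mono mult.commute)
      then show ?thesis using True by (simp flip: ennreal_mult)
    qed simp
  qed
  also have "\<dots> = ennreal (exp (- (x\<^sup>2 / (2 * s\<^sup>2)))) * emeasure (normal_measure 0 s) UNIV"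
    by (simp add: nn_integral_cmult normal_measure_def emeasure_density)
  also have "\<dots> = ennreal (exp (- (x\<^sup>2 / (2 * s\<^sup>2))))"
    using emeasure_space_1 by simp
  finally show ?thesis by (simp add: emeasure_eq_measure)
qed

lemma normal_lower_tail_le:
  assumes "0 < s" "0 \<le> x"
  shows "measure (normal_measure 0 s) {..- x} \<le> exp (- (x\<^sup>2 / (2 * s\<^sup>2)))"
proof -
  have "uminus -` {..- x} = {x..}" by auto
  then have "measure (normal_measure 0 s) {..- x} = measure (normal_measure 0 s) {x..}"
    by (subst distr_uminus_normal_measure[symmetric], subst measure_distr) auto
  then show ?thesis using normal_tail_le[OF assms] by simp
qed

text \<open>The density is decreasing, so its value at \<open>x + 1\<close> bounds the mass of \<open>[x, x + 1]\<close>.\<close>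

lemma normal_tail_ge:
  assumes "0 < s" "0 \<le> x"
  shows "normal_density 0 s (x + 1) \<le> measure (normal_measure 0 s) {x..}"
proof -
  interpret prob_space "normal_measure 0 s" by (rule prob_space_normal_measure) fact
  have "ennreal (normal_density 0 s (x + 1)) = (\<integral>\<^sup>+y. ennreal (normal_density 0 s (x + 1)) * indicator {x..x + 1} y \<partial>lborel)"
    by (subst nn_integral_cmult_indicator) auto
  also have "\<dots> \<le> (\<integral>\<^sup>+y. ennreal (normal_density 0 s y) * indicator {x..} y \<partial>lborel)"
  proof (intro nn_integral_mono)
    fix y
    show "ennreal (normal_density 0 s (x + 1)) * indicator {x..x + 1} y
        \<le> ennreal (normal_density 0 s y) * indicator {x..} y"
    proof (cases "y \<in> {x..x + 1}")
      case True
      then have "y\<^sup>2 \<le> (x + 1)\<^sup>2" using assms by (intro power_mono) auto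
      then have "normal_density 0 s (x + 1) \<le> normal_density 0 s y"
        unfolding normal_density_def using assms by (intro mult_left_mono) (auto intro!: divide_right_mono)
      then show ?thesis using True by (auto intro!: ennreal_leI)
    qed auto
  qed
  also have "\<dots> = emeasure (normal_measure 0 s) {x..}"
    by (simp add: normal_measure_def emeasure_density)
  finally show ?thesis by (simp add: emeasure_eq_measure)
qed

text \<open>Completing the square turns the tilted density into a multiple of the normal density of mean
  \<open>s\<^sup>2 t\<close>.\<close>

lemma normal_mgf:
  assumes "0 < s"
  shows "has_bochner_integral (normal_measure 0 s) (\<lambda>x. exp (t * x)) (exp (s\<^sup>2 * t\<^sup>2 / 2))"
proof (rule has_bochner_integral_nn_integral)
  have "normal_density 0 s x * exp (t * x) = exp (s\<^sup>2 * t\<^sup>2 / 2) * normal_density (s\<^sup>2 * t) s x" for x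
    using assms by (simp add: normal_density_def flip: exp_add) (simp add: field_simps power2_eq_square)
  then have "(\<integral>\<^sup>+x. ennreal (exp (t * x)) \<partial>normal_measure 0 s)
      = (\<integral>\<^sup>+x. ennreal (exp (s\<^sup>2 * t\<^sup>2 / 2)) * ennreal (normal_density (s\<^sup>2 * t) s x) \<partial>lborel)"
    by (subst nn_integral_normal_measure) (auto intro!: nn_integral_cong simp flip: ennreal_mult)
  also have "\<dots> = ennreal (exp (s\<^sup>2 * t\<^sup>2 / 2)) * emeasure (normal_measure (s\<^sup>2 * t) s) UNIV"
    by (simp add: nn_integral_cmult normal_measure_def emeasure_density)
  finally show "(\<integral>\<^sup>+x. ennreal (exp (t * x)) \<partial>normal_measure 0 s) = ennreal (exp (s\<^sup>2 * t\<^sup>2 / 2))"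
    using prob_space.emeasure_space_1[OF prob_space_normal_measure[OF assms]] by simp
qed auto

text \<open>Oddness allows replacing \<open>exp\<close> by \<open>cosh\<close>, which is monotone in the absolute value of its
  argument; hence the moment generating function can only decrease, and the subgaussian
  constant \<open>K\<close> is inherited without loss.\<close>

lemma odd_contraction_subgaussian:
  assumes K: "0 < K" and [measurable]: "T \<in> borel_measurable borel"
    and odd: "\<And>x. T (- x) = - T x" and contr: "\<And>x. \<bar>T x\<bar> \<le> \<bar>x\<bar>"
  shows "subgaussian K (distr (normal_measure 0 K) borel T)"
proof -
  define G where "G = normal_measure 0 K"
  interpret G: prob_space G unfolding G_def by (rule prob_space_normal_measure[OF K])
  have [measurable_cong]: "sets G = sets borel" by (simp add: G_def)
  have mgf: "has_bochner_integral G (\<lambda>x. exp (t * x)) (exp (K\<^sup>2 * t\<^sup>2 / 2))" for t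
    unfolding G_def by (rule normal_mgf[OF K])
  have le: "\<bar>exp (t * T x)\<bar> \<le> exp (t * x) + exp ((- t) * x)" for t x
  proof -
    have "t * T x \<le> \<bar>t\<bar> * \<bar>T x\<bar>" using abs_ge_self[of "t * T x"] by (simp add: abs_mult)
    also have "\<dots> \<le> \<bar>t\<bar> * \<bar>x\<bar>" using contr by (intro mult_left_mono) auto
    finally have "exp (t * T x) \<le> exp \<bar>t * x\<bar>" by (simp add: abs_mult)
    then show ?thesis by (auto simp: abs_if intro: add_increasing add_increasing2 split: if_splits)
  qed
  have int2: "integrable G (\<lambda>x. exp (t * x) + exp ((- t) * x))" for t
    by (intro Bochner_Integration.integrable_add integrable.intros[OF mgf])
  have intT: "integrable G (\<lambda>x. exp (t * T x))" for t
    by (rule Bochner_Integration.integrable_bound[OF int2[of t]]) (use le in auto)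
  have intid: "integrable G T"
  proof (rule Bochner_Integration.integrable_bound[OF int2[of 1]])
    have "\<bar>T x\<bar> \<le> exp x + exp (- x)" for x
      using contr[of x] exp_ge_add_one_self[of x] exp_ge_add_one_self[of "- x"] exp_gt_zero[of x] exp_gt_zero[of "- x"]
      by linarith
    then show "AE x in G. norm (T x) \<le> norm (exp (1 * x) + exp (- 1 * x))" by auto
  qed simp
  have reflect: "(\<integral>x. f (T x) \<partial>G) = (\<integral>x. f (- T x) \<partial>G)"
    if [measurable]: "f \<in> borel_measurable borel" for f :: "real \<Rightarrow> real"
  proof -
    have "(\<integral>x. f (T x) \<partial>G) = (\<integral>x. f (T x) \<partial>distr G borel uminus)"
      by (simp add: G_def distr_uminus_normal_measure)
    then show ?thesis by (simp add: integral_distr odd)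
  qed
  define P where "P = distr G borel T"
  have mean: "(\<integral>y. y \<partial>P) = 0"
    using reflect[of "\<lambda>x. x"] by (simp add: P_def integral_distr)
  have "(\<integral>x. exp (t * T x) \<partial>G) \<le> exp (K\<^sup>2 * t\<^sup>2 / 2)" for t
  proof -
    have "2 * (\<integral>x. exp (t * T x) \<partial>G) = (\<integral>x. exp (t * T x) \<partial>G) + (\<integral>x. exp ((- t) * T x) \<partial>G)"
      using reflect[of "\<lambda>x. exp (t * x)"] by simp
    also have "\<dots> = (\<integral>x. exp (t * T x) + exp ((- t) * T x) \<partial>G)"
      by (intro Bochner_Integration.integral_add[symmetric] intT)
    also have "\<dots> \<le> (\<integral>x. exp (t * x) + exp ((- t) * x) \<partial>G)"
    proof (intro integral_mono int2 Bochner_Integration.integrable_add intT)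
      fix x
      have "cosh (t * T x) = cosh \<bar>t * T x\<bar>" "cosh (t * x) = cosh \<bar>t * x\<bar>" by simp_all
      moreover have "\<bar>t * T x\<bar> \<le> \<bar>t * x\<bar>" using contr[of x] by (simp add: abs_mult mult_left_mono)
      ultimately have "cosh (t * T x) \<le> cosh (t * x)"
        by (metis abs_ge_zero cosh_real_nonneg_le_iff)
      then show "exp (t * T x) + exp ((- t) * T x) \<le> exp (t * x) + exp ((- t) * x)"
        by (simp add: cosh_def)
    qed
    also have "\<dots> = 2 * exp (K\<^sup>2 * t\<^sup>2 / 2)"
      using has_bochner_integral_add[OF mgf[of t] mgf[of "- t"]] by (simp add: has_bochner_integral_iff)
    finally show ?thesis by simp
  qed
  moreover have "real_distribution P"
    by (intro real_distribution.intro real_distribution_axioms.intro)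
       (auto simp: P_def intro!: G.prob_space_distr)
  ultimately have "subgaussian K P"
    using intid intT
    unfolding subgaussian_def mean by (auto simp: P_def integrable_distr_eq integral_distr)
  then show ?thesis by (simp add: P_def G_def)
qed

section \<open>Smoothing a measure with a gap\<close>

lemma real_distribution_convolution_normal:
  assumes "real_distribution P" "0 < s"
  shows "real_distribution (P \<star> normal_measure 0 s)"
proof -
  interpret P: real_distribution P by fact
  interpret N: prob_space "normal_measure 0 s" by (rule prob_space_normal_measure) fact
  interpret PN: pair_prob_space P "normal_measure 0 s" ..
  show ?thesis
    by (intro real_distribution.intro real_distribution_axioms.intro)
       (auto simp: convolution_def intro!: PN.prob_space_distr)
qed

text \<open>If \<open>P\<close> has no mass in \<open>(y, r)\<close>, then in a subinterval \<open>[a, b]\<close> the smoothed measure only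
  sees the Gaussian tail at distance \<open>a - y\<close> of the mass below the gap and the Gaussian tail at
  distance \<open>r - b\<close> of the mass above it, whereas most of the latter stays above \<open>b\<close>.\<close>

lemma
  assumes P: "real_distribution P" and s: "0 < s"
    and gap: "AE x in P. x \<le> y \<or> r \<le> x" and ab: "y \<le> a" "b \<le> r"
  shows convolution_normal_gap: "measure (P \<star> normal_measure 0 s) {a..b}
      \<le> exp (- ((a - y)\<^sup>2 / (2 * s\<^sup>2))) + exp (- ((r - b)\<^sup>2 / (2 * s\<^sup>2))) * measure P {r..}"
    and convolution_normal_tail:
      "(1 - exp (- ((r - b)\<^sup>2 / (2 * s\<^sup>2)))) * measure P {r..} \<le> measure (P \<star> normal_measure 0 s) {b<..}"
proof -
  interpret P: real_distribution P by fact
  interpret N: prob_space "normal_measure 0 s" by (rule prob_space_normal_measure) fact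
  interpret PN: real_distribution "P \<star> normal_measure 0 s"
    by (rule real_distribution_convolution_normal) fact+
  let ?N = "normal_measure 0 s"
  define t u where "t = exp (- ((a - y)\<^sup>2 / (2 * s\<^sup>2)))" and "u = exp (- ((r - b)\<^sup>2 / (2 * s\<^sup>2)))"
  have u: "0 \<le> u" "u \<le> 1" by (auto simp: u_def)
  have t: "0 \<le> t" by (simp add: t_def)
  have conv: "emeasure (P \<star> ?N) A = (\<integral>\<^sup>+x. emeasure ?N {z. z + x \<in> A} \<partial>P)" if "A \<in> sets borel" for A
    using that by (intro convolution_emeasure) (auto intro: P.finite_measure N.finite_measure)
  have low: "N.prob {z. z + x \<in> {a..b}} \<le> t" if "x \<le> y" for x
  proof -
    have "N.prob {z. z + x \<in> {a..b}} \<le> N.prob {a - y..}"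
      using that by (intro N.finite_measure_mono) auto
    also have "\<dots> \<le> t" unfolding t_def using ab by (intro normal_tail_le s) auto
    finally show ?thesis .
  qed
  have up: "N.prob {z. z + x \<in> {..b}} \<le> u" if "r \<le> x" for x
  proof -
    have "N.prob {z. z + x \<in> {..b}} \<le> N.prob {..- (r - b)}"
      using that by (intro N.finite_measure_mono) auto
    also have "\<dots> \<le> u" unfolding u_def using ab by (intro normal_lower_tail_le s) auto
    finally show ?thesis .
  qed
  have "emeasure (P \<star> ?N) {a..b} \<le> (\<integral>\<^sup>+x. ennreal t + ennreal u * indicator {r..} x \<partial>P)"
    unfolding conv[of "{a..b}", simplified]
  proof (intro nn_integral_mono_AE)
    show "AE x in P. emeasure ?N {z. a \<le> z + x \<and> z + x \<le> b} \<le> ennreal t + ennreal u * indicator {r..} x"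
      using gap
    proof eventually_elim
      fix x assume "x \<le> y \<or> r \<le> x"
      then show "emeasure ?N {z. a \<le> z + x \<and> z + x \<le> b} \<le> ennreal t + ennreal u * indicator {r..} x"
      proof
        assume "x \<le> y"
        from low[OF this] have "emeasure ?N {z. a \<le> z + x \<and> z + x \<le> b} \<le> ennreal t"
          by (simp add: N.emeasure_eq_measure ennreal_leI)
        then show ?thesis by (rule order_trans) simp
      next
        assume x: "r \<le> x"
        have "N.prob {z. a \<le> z + x \<and> z + x \<le> b} \<le> N.prob {z. z + x \<in> {..b}}"
          by (intro N.finite_measure_mono) auto
        with up[OF x] have "emeasure ?N {z. a \<le> z + x \<and> z + x \<le> b} \<le> ennreal u"
          by (simp add: N.emeasure_eq_measure ennreal_leI)
        then show ?thesis using x by (simp add: add_increasing)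
      qed
    qed
  qed
  also have "\<dots> = ennreal (t + u * measure P {r..})"
    using t u P.emeasure_space_1
    by (subst nn_integral_add)
       (auto simp: nn_integral_cmult_indicator P.emeasure_eq_measure ennreal_mult ennreal_plus)
  finally show "measure (P \<star> ?N) {a..b} \<le> t + u * measure P {r..}"
    using t u by (simp add: PN.emeasure_eq_measure del: ennreal_plus)
  have "ennreal ((1 - u) * measure P {r..}) = (\<integral>\<^sup>+x. ennreal (1 - u) * indicator {r..} x \<partial>P)"
    using u by (subst nn_integral_cmult_indicator) (auto simp: P.emeasure_eq_measure ennreal_mult)
  also have "\<dots> \<le> (\<integral>\<^sup>+x. emeasure ?N {z. z + x \<in> {b<..}} \<partial>P)"
  proof (intro nn_integral_mono)
    fix x
    show "ennreal (1 - u) * indicator {r..} x \<le> emeasure ?N {z. z + x \<in> {b<..}}"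
    proof (cases "r \<le> x")
      case True
      have "{z. z + x \<in> {b<..}} = space ?N - {z. z + x \<in> {..b}}" by auto
      then have "N.prob {z. z + x \<in> {b<..}} = 1 - N.prob {z. z + x \<in> {..b}}"
        by (simp only:) (rule N.prob_compl, simp)
      with up[OF True] True show ?thesis by (simp add: N.emeasure_eq_measure ennreal_leI)
    qed simp
  qed
  also have "\<dots> = emeasure (P \<star> ?N) {b<..}" by (rule conv[symmetric]) simp
  finally show "(1 - u) * measure P {r..} \<le> measure (P \<star> ?N) {b<..}"
    by (simp add: PN.emeasure_eq_measure)
qed

section \<open>Rounding to factorials\<close>

text \<open>Inserting \<open>0\<close> keeps the set nonempty for \<open>n = 0\<close>. Factorials are a convenient sequence
  in which each term is negligible compared with the next.\<close>

definition fact_below :: "nat \<Rightarrow> nat" where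
  "fact_below n = Max (insert 0 {fact k | k. fact k \<le> n})"

definition fact_round :: "real \<Rightarrow> real" where
  "fact_round x = sgn x * real (fact_below (nat \<lfloor>\<bar>x\<bar>\<rfloor>))"

lemma finite_facts_below: "finite {fact k :: nat | k. fact k \<le> (n :: nat)}"
  by (rule finite_subset[of _ "{..n}"]) auto

lemma fact_below_le: "fact_below n \<le> n"
  unfolding fact_below_def using finite_facts_below by (subst Max_le_iff) auto

lemma fact_le_fact_below: "fact k \<le> n \<Longrightarrow> fact k \<le> fact_below n"
  unfolding fact_below_def using finite_facts_below by (intro Max_ge) auto

lemma fact_below_gap: "fact_below n \<le> fact k \<or> fact (Suc k) \<le> fact_below n"
proof -
  have "fact_below n \<in> insert 0 {fact j | j. fact j \<le> n}"
    unfolding fact_below_def using finite_facts_below by (intro Max_in) auto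
  then consider "fact_below n = 0" | j where "fact_below n = fact j" by auto
  then show ?thesis
  proof cases
    case 2
    then show ?thesis using fact_mono[of j k] fact_mono[of "Suc k" j] by (metis not_less_eq_eq)
  qed simp
qed

lemma fact_round_measurable [measurable]: "fact_round \<in> borel_measurable borel"
  unfolding fact_round_def by measurable

lemma fact_round_uminus: "fact_round (- x) = - fact_round x"
  by (simp add: fact_round_def sgn_minus)

lemma abs_fact_round_le: "\<bar>fact_round x\<bar> \<le> \<bar>x\<bar>"
proof -
  have "real (fact_below (nat \<lfloor>\<bar>x\<bar>\<rfloor>)) \<le> real (nat \<lfloor>\<bar>x\<bar>\<rfloor>)" unfolding of_nat_le_iff by (rule fact_below_le)
  also have "\<dots> \<le> \<bar>x\<bar>" by (rule of_nat_floor) simp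
  finally show ?thesis by (simp add: fact_round_def abs_mult abs_sgn_eq)
qed

lemma fact_round_gap: "fact_round x \<le> fact k \<or> fact (Suc k) \<le> fact_round x"
proof (cases "x > 0")
  case True
  from fact_below_gap[of "nat \<lfloor>\<bar>x\<bar>\<rfloor>" k] show ?thesis
    using True unfolding fact_round_def
    by (metis abs_of_pos mult_1 of_nat_fact of_nat_le_iff sgn_pos)
next
  case False
  then have "fact_round x \<le> 0" by (auto simp: fact_round_def sgn_if)
  then show ?thesis using fact_ge_zero[of k] by (meson order_trans)
qed

lemma fact_le_fact_round: "fact k \<le> x \<Longrightarrow> fact k \<le> fact_round x"
proof -
  assume x: "fact k \<le> x"
  then have pos: "x > 0" using fact_gt_zero[of k] by (metis order_less_le_trans)
  have "real (fact k) \<le> x" using x by simp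
  then have "fact k \<le> nat \<lfloor>\<bar>x\<bar>\<rfloor>" using pos by (metis abs_of_pos le_nat_floor)
  then have "real (fact k) \<le> real (fact_below (nat \<lfloor>\<bar>x\<bar>\<rfloor>))"
    unfolding of_nat_le_iff by (rule fact_le_fact_below)
  then show ?thesis using pos by (simp add: fact_round_def)
qed

lemma filterlim_fact_Suc: "filterlim (\<lambda>k. fact (Suc k) :: real) at_top sequentially"
proof (rule filterlim_at_top_mono[OF filterlim_real_sequentially])
  have "real k \<le> fact (Suc k)" for k
    using fact_ge_self[of "Suc k"] of_nat_mono[of k "fact (Suc k)", where 'a=real]
    by (simp del: fact_Suc)
  then show "\<forall>\<^sub>F k in sequentially. real k \<le> fact (Suc k)" by simp
qed

section \<open>A bottlenecked smoothed subgaussian distribution\<close>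

text \<open>The comparison that uses \<open>\<sigma> < K\<close>: a Gaussian of larger rate is eventually smaller, whatever
  the shifts and constant factors.\<close>

lemma eventually_gaussian_le_gaussian:
  fixes \<beta> \<gamma> c D :: real
  assumes "0 < \<beta>" "\<beta> < \<gamma>" "0 < D"
  shows "eventually (\<lambda>r. exp (- ((\<gamma> * r - c)\<^sup>2 / 2)) \<le> D * exp (- ((\<beta> * (r + 1))\<^sup>2 / 2))) at_top"
proof -
  have "filterlim (\<lambda>r. (\<gamma> - \<beta>) * r - (c + \<beta>)) at_top at_top" "filterlim (\<lambda>r. (\<gamma> + \<beta>) * r - (c - \<beta>)) at_top at_top"
    using assms by real_asymp+
  then have "filterlim (\<lambda>r. ((\<gamma> - \<beta>) * r - (c + \<beta>)) * ((\<gamma> + \<beta>) * r - (c - \<beta>))) at_top at_top"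
    by (rule filterlim_at_top_mult_at_top)
  then have "eventually (\<lambda>r. - 2 * ln D \<le> ((\<gamma> - \<beta>) * r - (c + \<beta>)) * ((\<gamma> + \<beta>) * r - (c - \<beta>))) at_top"
    by (simp add: filterlim_at_top)
  then show ?thesis
  proof eventually_elim
    case (elim r)
    have "((\<gamma> - \<beta>) * r - (c + \<beta>)) * ((\<gamma> + \<beta>) * r - (c - \<beta>)) = (\<gamma> * r - c)\<^sup>2 - (\<beta> * (r + 1))\<^sup>2"
      by (simp add: power2_eq_square algebra_simps)
    with elim have "- ((\<gamma> * r - c)\<^sup>2 / 2) \<le> ln D + - ((\<beta> * (r + 1))\<^sup>2 / 2)"
      by simp
    then have "exp (- ((\<gamma> * r - c)\<^sup>2 / 2)) \<le> exp (ln D + - ((\<beta> * (r + 1))\<^sup>2 / 2))" by simp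
    also have "\<dots> = D * exp (- ((\<beta> * (r + 1))\<^sup>2 / 2))" using assms by (simp only: exp_add exp_ln)
    finally show ?case .
  qed
qed

text \<open>The bottleneck is placed at distance \<open>4 \<sigma>\<close> below the factorial \<open>r = (k + 1)!\<close>. At that
  distance the Gaussian tail is at most \<open>exp (-8) \<le> 1 / 9\<close>, so the mass \<open>p\<close> of \<open>P\<close> above the
  gap leaks at most \<open>p / 9\<close> below \<open>b\<close>. The mass below the gap contributes at most \<open>p / 3\<close> if
  \<open>k\<close> is large, and \<open>1 / 3 + 1 / 9 = (1 - 1 / 9) / 2\<close>.\<close>

lemma rounded_normal_bottlenecked:
  fixes K \<sigma> :: real
  assumes \<sigma>: "0 < \<sigma>" "\<sigma> < K"
  shows "bottlenecked (distr (normal_measure 0 K) borel fact_round \<star> normal_measure 0 \<sigma>)"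
  unfolding bottlenecked_def
proof (intro allI impI)
  fix L \<epsilon> :: real assume L: "0 < L" and \<epsilon>: "0 < \<epsilon>"
  define P where "P = distr (normal_measure 0 K) borel fact_round"
  have K: "0 < K" using \<sigma> by simp
  interpret G: prob_space "normal_measure 0 K" by (rule prob_space_normal_measure[OF K])
  have P: "real_distribution P"
    by (intro real_distribution.intro real_distribution_axioms.intro)
       (auto simp: P_def intro!: G.prob_space_distr)
  interpret \<nu>: real_distribution "P \<star> normal_measure 0 \<sigma>"
    by (rule real_distribution_convolution_normal[OF P \<sigma>(1)])
  \<comment> \<open>The rate \<open>\<gamma>\<close> lies halfway between \<open>1 / K\<close> and \<open>1 / \<sigma>\<close>. It is the rate that remains when
    the distance \<open>r\<close> is shortened to \<open>(1 - \<theta>) r\<close> to account for \<open>k! \<le> \<theta> (k + 1)!\<close>.\<close>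
  define \<beta> \<gamma> \<theta> where "\<beta> = 1 / K" and "\<gamma> = (1 / \<sigma> + 1 / K) / 2" and "\<theta> = (1 - \<sigma> / K) / 2"
  have \<beta>: "0 < \<beta>" using K by (simp add: \<beta>_def)
  have \<gamma>: "\<beta> < \<gamma>" using \<sigma> by (simp add: \<beta>_def \<gamma>_def field_simps)
  have \<theta>: "0 < \<theta>" "\<gamma> = (1 - \<theta>) / \<sigma>" using \<sigma> by (auto simp: \<theta>_def \<gamma>_def field_simps)
  define c D where "c = (4 * \<sigma> + L) / \<sigma>" and "D = 1 / sqrt (2 * pi * K\<^sup>2) / 3"
  have D: "0 < D" using K by (simp add: D_def)
  define r y :: "nat \<Rightarrow> real" where "r k = fact (Suc k)" and "y k = fact k" for k
  have r_top: "filterlim r at_top sequentially" unfolding r_def[abs_def] by (rule filterlim_fact_Suc)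
  have "\<forall>\<^sub>F k in sequentially. exp (- ((\<gamma> * r k - c)\<^sup>2 / 2)) \<le> D * exp (- ((\<beta> * (r k + 1))\<^sup>2 / 2))"
    using eventually_compose_filterlim[OF eventually_gaussian_le_gaussian[OF \<beta> \<gamma> D] r_top] .
  moreover have "\<forall>\<^sub>F k in sequentially. c / \<gamma> \<le> r k"
    using r_top by (auto simp: filterlim_at_top)
  moreover have "\<forall>\<^sub>F k in sequentially. 1 / \<theta> \<le> real k"
    using filterlim_real_sequentially by (auto simp: filterlim_at_top)
  moreover have "\<forall>\<^sub>F k in sequentially. 1 - \<epsilon> < cdf (P \<star> normal_measure 0 \<sigma>) (r k - 4 * \<sigma>)"
  proof -
    have "filterlim (\<lambda>k. - (4 * \<sigma>) + r k) at_top sequentially"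
      by (intro filterlim_tendsto_add_at_top[OF tendsto_const r_top])
    then have "((\<lambda>k. cdf (P \<star> normal_measure 0 \<sigma>) (r k - 4 * \<sigma>)) \<longlongrightarrow> 1) sequentially"
      using filterlim_compose[OF \<nu>.cdf_lim_at_top_prob] by (simp add: add.commute)
    then show ?thesis using \<epsilon> by (intro order_tendstoD) auto
  qed
  ultimately have "\<forall>\<^sub>F k in sequentially.
      exp (- ((\<gamma> * r k - c)\<^sup>2 / 2)) \<le> D * exp (- ((\<beta> * (r k + 1))\<^sup>2 / 2)) \<and>
      c / \<gamma> \<le> r k \<and> 1 / \<theta> \<le> real k \<and> 1 - \<epsilon> < cdf (P \<star> normal_measure 0 \<sigma>) (r k - 4 * \<sigma>)"
    by eventually_elim auto
  then obtain k where k: "exp (- ((\<gamma> * r k - c)\<^sup>2 / 2)) \<le> D * exp (- ((\<beta> * (r k + 1))\<^sup>2 / 2))"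
      "c / \<gamma> \<le> r k" "1 / \<theta> \<le> real k" "1 - \<epsilon> < cdf (P \<star> normal_measure 0 \<sigma>) (r k - 4 * \<sigma>)"
    using eventually_happens'[OF sequentially_bot] by blast
  define b a p where "b = r k - 4 * \<sigma>" and "a = b - L" and "p = measure P {r k..}"
  have r_pos: "0 < r k" by (simp add: r_def del: fact_Suc)
  have "r k = (real k + 1) * y k" by (simp add: r_def y_def)
  moreover have "1 \<le> \<theta> * (real k + 1)" using k(3) \<theta>(1) by (simp add: field_simps)
  ultimately have "y k \<le> \<theta> * r k" using mult_right_mono[of 1 "\<theta> * (real k + 1)" "y k"]
    by (simp add: y_def mult.assoc)
  then have far: "\<sigma> * (\<gamma> * r k - c) \<le> a - y k"
  proof -
    have "\<sigma> * (\<gamma> * r k - c) = r k - \<theta> * r k - (4 * \<sigma> + L)"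
      using \<sigma>(1) by (simp add: \<theta>(2) c_def field_simps)
    then show ?thesis using \<open>y k \<le> \<theta> * r k\<close> by (simp add: a_def b_def)
  qed
  have "0 \<le> \<gamma> * r k - c" using k(2) \<beta> \<gamma> by (simp add: field_simps)
  then have far0: "0 \<le> \<sigma> * (\<gamma> * r k - c)" using \<sigma> by simp
  have p_ge: "D * exp (- ((\<beta> * (r k + 1))\<^sup>2 / 2)) \<le> p / 3"
  proof -
    have "{r k..} \<subseteq> fact_round -` {r k..}"
      using fact_le_fact_round by (auto simp: r_def simp del: fact_Suc)
    then have "measure (normal_measure 0 K) {r k..} \<le> measure (normal_measure 0 K) (fact_round -` {r k..})"
      using measurable_sets[OF fact_round_measurable, of "{r k..}"]
      by (intro G.finite_measure_mono) auto
    also have "\<dots> = p" unfolding p_def P_def by (subst measure_distr) auto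
    finally have "normal_density 0 K (r k + 1) \<le> p"
      using normal_tail_ge[OF K, of "r k"] r_pos by simp
    moreover have "D * exp (- ((\<beta> * (r k + 1))\<^sup>2 / 2)) = normal_density 0 K (r k + 1) / 3"
      by (simp add: normal_density_def D_def \<beta>_def power_divide mult.commute)
    ultimately show ?thesis by simp
  qed
  have p: "0 < p" using p_ge D by (smt (verit) divide_pos_pos exp_gt_zero mult_pos_pos zero_less_divide_iff)
  have "exp (- ((a - y k)\<^sup>2 / (2 * \<sigma>\<^sup>2))) \<le> exp (- ((\<gamma> * r k - c)\<^sup>2 / 2))"
  proof -
    have "(\<sigma> * (\<gamma> * r k - c))\<^sup>2 \<le> (a - y k)\<^sup>2" using far far0 by (rule power_mono)
    then have "(\<sigma> * (\<gamma> * r k - c))\<^sup>2 / (2 * \<sigma>\<^sup>2) \<le> (a - y k)\<^sup>2 / (2 * \<sigma>\<^sup>2)"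
      by (rule divide_right_mono) simp
    then show ?thesis using \<sigma> by (simp add: power_mult_distrib)
  qed
  with k(1) p_ge have near: "exp (- ((a - y k)\<^sup>2 / (2 * \<sigma>\<^sup>2))) \<le> p / 3" by linarith
  define u where "u = exp (- ((r k - b)\<^sup>2 / (2 * \<sigma>\<^sup>2)))"
  have u: "u \<le> 1 / 9"
  proof -
    have "u = exp (- 8)" using \<sigma> by (simp add: u_def b_def power_mult_distrib)
    moreover have "9 * exp (- 8) \<le> exp 8 * exp (- 8 :: real)"
      using exp_ge_add_one_self[of "8 :: real"] by (intro mult_right_mono) auto
    ultimately show ?thesis by (simp flip: exp_add)
  qed
  have gap: "AE x in P. x \<le> y k \<or> r k \<le> x"
    unfolding P_def y_def r_def using fact_round_gap by (subst AE_distr_iff) auto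
  have ab: "y k \<le> a" "b \<le> r k" using far far0 \<sigma> by (auto simp: b_def)
  have thin: "measure (P \<star> normal_measure 0 \<sigma>) {a..b} \<le> p / 3 + u * p"
    using convolution_normal_gap[OF P \<sigma>(1) gap ab] near by (simp add: u_def p_def)
  have thick: "p - u * p \<le> measure (P \<star> normal_measure 0 \<sigma>) {b<..}"
    using convolution_normal_tail[OF P \<sigma>(1) gap ab] by (simp add: u_def p_def left_diff_distrib)
  have up: "u * p \<le> p / 9" using u p mult_right_mono[of u "1/9" p] by simp
  have "measure (P \<star> normal_measure 0 \<sigma>) {b<..} < \<epsilon>"
    using k(4) \<nu>.prob_compl[of "{..b}"] by (simp add: b_def cdf_def Compl_eq_Diff_UNIV[symmetric])
  moreover have "0 < measure (P \<star> normal_measure 0 \<sigma>) {b<..}"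
    using thick up p by linarith
  moreover have "measure (P \<star> normal_measure 0 \<sigma>) {a..b} \<le> measure (P \<star> normal_measure 0 \<sigma>) {b<..} / 2"
    using thin thick up by linarith
  moreover have "L \<le> b - a" by (simp add: a_def)
  ultimately show "\<exists>a b. L \<le> b - a \<and>
      0 < measure (distr (normal_measure 0 K) borel fact_round \<star> normal_measure 0 \<sigma>) {b<..} \<and>
      measure (distr (normal_measure 0 K) borel fact_round \<star> normal_measure 0 \<sigma>) {b<..} < \<epsilon> \<and>
      measure (distr (normal_measure 0 K) borel fact_round \<star> normal_measure 0 \<sigma>) {a..b}
        \<le> measure (distr (normal_measure 0 K) borel fact_round \<star> normal_measure 0 \<sigma>) {b<..} / 2"
    unfolding P_def by blast
qed

theorem corollary1:
  fixes K \<sigma> :: real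
  assumes "0 < \<sigma>" and "\<sigma> < K"
  shows "\<exists>P. subgaussian K P \<and>
           \<not> satisfies_T2 (P \<star> normal_measure 0 \<sigma>) \<and>
           T2_constant (P \<star> normal_measure 0 \<sigma>) = \<infinity> \<and>
           \<not> satisfies_LSI (P \<star> normal_measure 0 \<sigma>)"
proof -
  define P where "P = distr (normal_measure 0 K) borel fact_round"
  have subg: "subgaussian K P"
    unfolding P_def using assms
    by (intro odd_contraction_subgaussian fact_round_uminus abs_fact_round_le) auto
  then have \<nu>: "real_distribution (P \<star> normal_measure 0 \<sigma>)"
    using assms by (intro real_distribution_convolution_normal) (auto simp: subgaussian_def)
  have bott: "bottlenecked (P \<star> normal_measure 0 \<sigma>)"
    unfolding P_def using assms by (rule rounded_normal_bottlenecked)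
  have no_T2: "\<not> T2_inequality (P \<star> normal_measure 0 \<sigma>) C" for C
    by (rule bottlenecked_not_T2_inequality[OF \<nu> bott])
  then have "T2_constant (P \<star> normal_measure 0 \<sigma>) = \<infinity>"
    by (simp add: T2_constant_def top_ereal_def)
  with subg no_T2 bottlenecked_not_satisfies_LSI[OF \<nu> bott] show ?thesis
    unfolding satisfies_T2_def by blast
qed

end
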